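(* Let $T$ be any tree poset of height $2$ with $t+1$ elements. Then for any $\varepsilon>0$ there exist $\delta>0$ and $n_0$ such that for any $n\ge n_0$, any family $\mathcal F\subseteq 2^{[n]}$ of size $|\mathcal F|\ge(1+\varepsilon)\binom{n}{\lfloor n/2\rfloor}$ contains at least $\delta n^t\binom{n}{\lfloor n/2\rfloor}$ copies of $T$.
   Context: For a finite poset $(P,\le)$ and a family $\mathcal F\subseteq 2^{[n]}$, a (non-induced) copy of $P$ in $\mathcal F$ is a subfamily $\mathcal G\subseteq\mathcal F$ for which there is a bijection $i:P\to\mathcal G$ such that $p\le q$ implies $i(p)\subseteq i(q)$. The Hasse diagram of $P$ is the directed graph on $P$ with an arc $pq$ whenever $p<q$ and there is no $z$ with $p<z<q$. $P$ is a tree poset if its Hasse diagram with orientations removed is a tree. The height of $P$ is the maximum number of elements in a chain of $P$. *)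

theory Defs
  imports Complex_Main "Graph_Theory.Digraph_Component"
begin

text \<open>A finite poset is given by a carrier \<open>P\<close> and a reflexive order relation \<open>r\<close> with
  \<open>partial_order_on P r\<close>; \<open>(p, q) \<in> r\<close> is read as \<open>p \<le> q\<close>.\<close>

definition hasse_diagram :: "'a set \<Rightarrow> 'a rel \<Rightarrow> 'a pair_pre_digraph" where
  "hasse_diagram P r =
     \<lparr> pverts = P,
       parcs = {(p, q). p \<in> P \<and> q \<in> P \<and> (p, q) \<in> r \<and> p \<noteq> q \<and>
                  \<not> (\<exists>z\<in>P. (p, z) \<in> r \<and> p \<noteq> z \<and> (z, q) \<in> r \<and> z \<noteq> q)} \<rparr>"

text \<open>The constant \<^const>\<open>Digraph_Component.tree\<close> only excludes directed cycles, which a Hasse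
  diagram never has, and therefore does not express that the underlying undirected graph is a
  tree. An undirected cycle is a cycle of the symmetric closure of length at least 3: a cycle of
  length 2 in \<^const>\<open>mk_symmetric\<close> merely walks along one edge back and forth. (This reading
  presupposes a digraph without antiparallel arcs, as Hasse diagrams are.)\<close>

definition underlying_tree :: "'a pair_pre_digraph \<Rightarrow> bool" where
  "underlying_tree D \<longleftrightarrow>
     Digraph_Component.connected (with_proj D) \<and>
     \<not> (\<exists>c. pre_digraph.cycle (with_proj (mk_symmetric (with_proj D))) c \<and> 3 \<le> length c)"

definition tree_poset :: "'a set \<Rightarrow> 'a rel \<Rightarrow> bool" where
  "tree_poset P r \<longleftrightarrow> underlying_tree (hasse_diagram P r)"

definition poset_height :: "'a set \<Rightarrow> 'a rel \<Rightarrow> nat" where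
  "poset_height P r = Max {card C | C. C \<subseteq> P \<and> C \<in> Chains r}"

text \<open>Copies are subfamilies, not embeddings: different bijections onto the same subfamily
  count once.\<close>

definition poset_copies :: "'a set \<Rightarrow> 'a rel \<Rightarrow> 'b set set \<Rightarrow> 'b set set set" where
  "poset_copies P r \<F> =
     {\<G>. \<G> \<subseteq> \<F> \<and>
         (\<exists>i. bij_betw i P \<G> \<and> (\<forall>p\<in>P. \<forall>q\<in>P. (p, q) \<in> r \<longrightarrow> i p \<subseteq> i q))}"

end

theory Submission
  imports Defs "HOL-Combinatorics.Multiset_Permutations" "HOL-Library.FuncSet"
begin

text \<open>Weigh each \<open>A \<in> \<F>\<close> by \<open>(n choose |A|) / (n choose n div 2)\<close>. A uniformly random maximal chain
  of \<open>Pow [n]\<close> meets \<open>\<F>\<close> in expected weight \<open>1 + \<epsilon>\<close>, and all but weight 1 of it can be charged to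
  comparable pairs on the chain. Once \<open>[n]\<close> is removed, a pair lies on the chain with probability smaller by
  a factor \<open>O(1/n)\<close> than its member farther from the middle, so there are \<open>\<Omega>(\<epsilon> n (n choose n div 2))\<close>
  comparable pairs. After discarding vertices of small degree, every remaining vertex has degree
  linear in \<open>n\<close>. As \<open>T\<close> has height 2, each of its elements is only a lower or only an upper
  one, so \<open>T\<close> embeds greedily: start from any remaining pair as the image of an edge and attach
  the other \<open>t - 1\<close> elements one by one, with linearly many choices each time.\<close>

section \<open>Random maximal chains and a lower bound on comparable pairs\<close>

text \<open>Pascal's rule adds a positive term to the inductive bound; \<open>k = m\<close> follows
  by symmetry. This is the source of the factor of order 1/n in the probability of a pair.\<close>

lemma le_binomial:
  fixes m k :: nat
  assumes "0 < k" "k < m"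
  shows "m \<le> m choose k"
  using assms
proof (induction m arbitrary: k)
  case (Suc m)
  then obtain j where j: "k = Suc j" by (cases k) auto
  show ?case
  proof (cases "k = m")
    case False
    then have "m \<le> m choose k" using Suc by simp
    moreover have "0 < m choose j" using Suc.prems j by simp
    ultimately show ?thesis unfolding j binomial_Suc_Suc by linarith
  qed (simp add: binomial_symmetric)
qed simp

text \<open>A permutation of \<open>U\<close> encodes the maximal chain of the sets of its prefixes,
  so the condition says that this chain passes through \<open>A\<close>. Concatenating an ordering
  of \<open>A\<close> with one of \<open>U - A\<close> produces such permutations
  injectively.\<close>

lemma card_permutations_prefix:
  assumes "finite U" "A \<subseteq> U"
  shows "fact (card A) * fact (card U - card A)
    \<le> card {xs \<in> permutations_of_set U. set (take (card A) xs) = A}"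
proof -
  have fin: "finite A" "finite (U - A)" using assms finite_subset by auto
  let ?D = "permutations_of_set A \<times> permutations_of_set (U - A)"
  have len: "length ys = card A" if "ys \<in> permutations_of_set A" for ys
    using that by (simp add: length_finite_permutations_of_set)
  have inj: "inj_on (\<lambda>(ys, zs). ys @ zs) ?D"
    by (auto simp: inj_on_def len)
  have sub: "(\<lambda>(ys, zs). ys @ zs) ` ?D
      \<subseteq> {xs \<in> permutations_of_set U. set (take (card A) xs) = A}"
  proof clarify
    fix ys zs assume yz: "ys \<in> permutations_of_set A" "zs \<in> permutations_of_set (U - A)"
    then show "ys @ zs \<in> permutations_of_set U \<and> set (take (card A) (ys @ zs)) = A"
      using assms len[OF yz(1)] by (auto simp: permutations_of_set_def)
  qed
  have "card ?D = fact (card A) * fact (card U - card A)"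
    using fin assms by (simp add: card_cartesian_product card_Diff_subset)
  with card_image[OF inj] card_mono[OF _ sub] show ?thesis by simp
qed

text \<open>Cutting a permutation at positions \<open>card A\<close> and \<open>card B\<close>
  leaves orderings of \<open>A\<close>, \<open>B - A\<close> and \<open>U - B\<close>, from which it
  is recovered by concatenation. Pairs enter the double count on the larger side, hence an upper
  bound here.\<close>

lemma card_permutations_two_prefixes:
  assumes "finite U" "A \<subseteq> B" "B \<subseteq> U"
  shows "card {xs \<in> permutations_of_set U. set (take (card A) xs) = A \<and> set (take (card B) xs) = B}
    \<le> fact (card A) * fact (card B - card A) * fact (card U - card B)"
proof -
  have fin: "finite B" "finite A" using assms by (auto intro: finite_subset)
  let ?D = "permutations_of_set A \<times> permutations_of_set (B - A) \<times> permutations_of_set (U - B)"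
  have "{xs \<in> permutations_of_set U. set (take (card A) xs) = A \<and> set (take (card B) xs) = B}
      \<subseteq> (\<lambda>(xs, ys, zs). xs @ ys @ zs) ` ?D"
  proof clarify
    fix xs assume xs: "xs \<in> permutations_of_set U"
      and A: "set (take (card A) xs) = A" and B: "set (take (card B) xs) = B"
    define ys where "ys = drop (card A) (take (card B) xs)"
    have AB: "card A \<le> card B" using assms fin by (simp add: card_mono)
    have B_split: "take (card B) xs = take (card A) xs @ ys"
      using AB unfolding ys_def by (metis append_take_drop_id min.absorb1 take_take)
    then have split: "xs = take (card A) xs @ ys @ drop (card B) xs"
      by (metis append.assoc append_take_drop_id)
    have dist: "distinct xs" and set: "set xs = U" using xs by (auto simp: permutations_of_set_def)
    have d: "distinct (take (card A) xs @ ys @ drop (card B) xs)" using dist split by simp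
    have "set (take (card B) xs) = set (take (card A) xs) \<union> set ys" using B_split by simp
    then have ys: "set ys = B - A" using d A B by auto
    have "set xs = set (take (card B) xs) \<union> set (drop (card B) xs)"
      by (metis append_take_drop_id set_append)
    then have zs: "set (drop (card B) xs) = U - B" using d A B ys set assms by auto
    have "(take (card A) xs, ys, drop (card B) xs) \<in> ?D"
      using d A ys zs by (auto simp: permutations_of_set_def)
    then show "xs \<in> (\<lambda>(xs, ys, zs). xs @ ys @ zs) ` ?D"
      using split by force
  qed
  then have "card {xs \<in> permutations_of_set U. set (take (card A) xs) = A \<and> set (take (card B) xs) = B}
      \<le> card ?D"
    by (rule surj_card_le[rotated]) simp
  also have "card ?D = fact (card A) * fact (card B - card A) * fact (card U - card B)"
    using fin assms by (simp add: card_cartesian_product card_Diff_subset mult.assoc)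
  finally show ?thesis .
qed

text \<open>Every member of the chain other than one suitably chosen \<open>K\<close> is charged to its pair with
  \<open>K\<close>; the choice of \<open>K\<close> makes the charged member the one that is farther from the middle.\<close>

lemma chain_weight_le:
  fixes w :: "'b set \<Rightarrow> real" and low :: "'b set \<Rightarrow> bool"
  assumes "finite S" and fin: "\<And>A. A \<in> S \<Longrightarrow> finite A"
    and chain: "\<And>A B. A \<in> S \<Longrightarrow> B \<in> S \<Longrightarrow> A \<subseteq> B \<or> B \<subseteq> A"
    and w: "\<And>A. 0 \<le> w A" "\<And>A. w A \<le> 1"
    and low: "\<And>A B. A \<in> S \<Longrightarrow> B \<in> S \<Longrightarrow> A \<subseteq> B \<Longrightarrow> low B \<Longrightarrow> low A"
  shows "sum w S \<le> 1 + (\<Sum>(A, B) \<in> {(A, B). A \<in> S \<and> B \<in> S \<and> A \<subset> B}. if low A then w A else w B)"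
    (is "_ \<le> 1 + sum ?W ?P")
proof (cases "S = {}")
  case True
  then show ?thesis by simp
next
  case False
  \<comment> \<open>\<open>K\<close> is the least member that is not \<open>low\<close>, or the
    greatest member if all are \<open>low\<close>. Then the pair of \<open>A\<close> with
    \<open>K\<close> has weight exactly \<open>w A\<close>: either \<open>A\<close> is its smaller
    part and \<open>low\<close>, or \<open>K\<close> is its smaller part and not \<open>low\<close>.
    Only \<open>w K\<close> remains uncharged, which gives the summand 1.\<close>
  have "\<exists>K\<in>S. \<forall>A\<in>S - {K}. (low A \<and> A \<subset> K) \<or> (\<not> low K \<and> K \<subset> A)"
  proof (cases "\<exists>A\<in>S. \<not> low A")
    case True
    then have "{A \<in> S. \<not> low A} \<noteq> {}" "finite {A \<in> S. \<not> low A}" using assms(1) by auto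
    from finite_has_minimal[OF this(2,1)]
    obtain K where K: "K \<in> {A \<in> S. \<not> low A}"
      and min: "\<And>A. A \<in> {A \<in> S. \<not> low A} \<Longrightarrow> A \<subseteq> K \<Longrightarrow> A = K"
      by blast
    show ?thesis
    proof (intro bexI[of _ K] ballI)
      fix A assume A: "A \<in> S - {K}"
      show "(low A \<and> A \<subset> K) \<or> (\<not> low K \<and> K \<subset> A)"
        using A K chain[of A K] min[of A] low[of K A] by blast
    qed (use K in auto)
  next
    case all: False
    obtain K where K: "K \<in> S" and max: "\<And>A. A \<in> S \<Longrightarrow> K \<subseteq> A \<Longrightarrow> A = K"
      using finite_has_maximal[OF assms(1) \<open>S \<noteq> {}\<close>] by blast
    show ?thesis
    proof (intro bexI[OF _ K] ballI disjI1 conjI)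
      fix A assume A: "A \<in> S - {K}"
      then show "low A" using all by blast
      show "A \<subset> K" using A chain[of A K] K max[of A] by blast
    qed
  qed
  then obtain K where K: "K \<in> S"
    and star: "\<And>A. A \<in> S - {K} \<Longrightarrow> (low A \<and> A \<subset> K) \<or> (\<not> low K \<and> K \<subset> A)"
    by blast
  define e where "e A = (if low A \<and> A \<subset> K then (A, K) else (K, A))" for A
  have inj: "inj_on e (S - {K})" unfolding inj_on_def e_def by (auto split: if_splits)
  have val: "?W (e A) = w A" if "A \<in> S - {K}" for A
    using star[OF that] by (auto simp: e_def)
  have sub: "e ` (S - {K}) \<subseteq> ?P"
  proof (rule image_subsetI)
    fix A assume A: "A \<in> S - {K}"
    show "e A \<in> ?P" using star[OF A] A K by (auto simp: e_def)
  qed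
  have "sum w (S - {K}) = sum ?W (e ` (S - {K}))"
    unfolding sum.reindex[OF inj] using val by (intro sum.cong) (simp_all only: o_apply)
  also have "\<dots> \<le> sum ?W ?P"
  proof (rule sum_mono2[OF _ sub])
    show "finite ?P" by (rule finite_subset[of _ "S \<times> S"]) (use assms(1) in auto)
  qed (use w in \<open>auto split: prod.splits\<close>)
  finally show ?thesis using w(2)[of K] sum.remove[OF assms(1) K, of w] by linarith
qed

text \<open>The factorials cancel to \<open>fact n / c\<close> divided by
  \<open>(n - a) choose (b - a)\<close> if \<open>a\<close> is below the middle, and by
  \<open>b choose a\<close> otherwise. Either binomial coefficient is at least its upper entry by
  \<open>le_binomial\<close>, hence at least n/2. In the first case \<open>b < n\<close> is what
  keeps its lower entry below the upper one.\<close>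

lemma weight_times_pair_permutations_le:
  fixes n a b :: nat
  assumes ab: "a < b" and bn: "b < n"
  defines "c \<equiv> real (n choose (n div 2))"
  shows "(if 2 * a < n then real (n choose a) / c else real (n choose b) / c)
      * (fact a * fact (b - a) * fact (n - b)) \<le> fact n / c * (2 / n)"
proof -
  have c: "c > 0" unfolding c_def by simp
  have key: "fact n / c / real m \<le> fact n / c * (2 / n)" if "n \<le> 2 * m" for m
  proof -
    have "1 / real m \<le> 2 / n" using that ab bn by (simp add: field_simps)
    then have "fact n / c * (1 / real m) \<le> fact n / c * (2 / n)"
      using c by (intro mult_left_mono) auto
    then show ?thesis by simp
  qed
  show ?thesis
  proof (cases "2 * a < n")
    case True
    have "n - a - (b - a) = n - b" using ab by simp
    then have e1: "real ((n - a) choose (b - a)) = fact (n - a) / (fact (b - a) * fact (n - b))"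
      using binomial_fact[of "b - a" "n - a", where 'a = real] ab bn by simp
    have e2: "real (n choose a) = fact n / (fact a * fact (n - a))"
      using ab bn by (intro binomial_fact) auto
    have "real (n choose a) / c * (fact a * fact (b - a) * fact (n - b))
        = fact n / c / real ((n - a) choose (b - a))"
      unfolding e1 e2 using c by (simp add: field_simps)
    also have "\<dots> \<le> fact n / c * (2 / n)"
      using le_binomial[of "b - a" "n - a"] ab bn True by (intro key) linarith
    finally show ?thesis using True by simp
  next
    case False
    have e1: "real (b choose a) = fact b / (fact a * fact (b - a))"
      using ab by (intro binomial_fact) auto
    have e2: "real (n choose b) = fact n / (fact b * fact (n - b))"
      using ab bn by (intro binomial_fact) auto
    have "real (n choose b) / c * (fact a * fact (b - a) * fact (n - b))
        = fact n / c / real (b choose a)"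
      unfolding e1 e2 using c by (simp add: field_simps)
    also have "\<dots> \<le> fact n / c * (2 / n)"
      using le_binomial[of a b] ab bn False by (intro key) linarith
    finally show ?thesis using False by simp
  qed
qed

text \<open>The chain inequality is summed over all n! permutations. Every member of
  \<open>F\<close> contributes at least n!/c, since its weight cancels the dependence on its size,
  and every comparable pair at most (n!/c)(2/n). Dividing by n! leaves |F|/c \<le> 1 + 2|P|/(cn).
  Since \<open>U \<notin> F\<close>, the larger set of a pair is a proper subset of
  \<open>U\<close>.\<close>

lemma comparable_pairs_lower_bound:
  fixes F :: "'b set set"
  assumes U: "finite U" "U \<noteq> {}" and F: "F \<subseteq> Pow U" "U \<notin> F"
  shows "real (card U) * (real (card F) - real (card U choose (card U div 2)))
    \<le> 2 * real (card {(A, B). A \<in> F \<and> B \<in> F \<and> A \<subset> B})"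
proof -
  define n where "n = card U"
  define c where "c = real (n choose (n div 2))"
  define w where "w A = real (n choose (card A)) / c" for A :: "'b set"
  define W where "W = (\<lambda>(A, B). if 2 * card A < n then w A else w B)"
  define P where "P = {(A, B). A \<in> F \<and> B \<in> F \<and> A \<subset> B}"
  define X where "X = permutations_of_set U"
  have n: "n > 0" using U by (simp add: n_def card_gt_0_iff)
  have c: "c > 0" unfolding c_def by simp
  have finF: "finite F" using F U finite_subset by auto
  have finP: "finite P" by (rule finite_subset[of _ "F \<times> F"]) (use finF in \<open>auto simp: P_def\<close>)
  have finX: "finite X" by (simp add: X_def)
  have cardX: "card X = fact n" using U by (simp add: X_def n_def)
  define ch where "ch xs A \<longleftrightarrow> set (take (card A) xs) = A" for xs :: "'b list" and A
  have chain: "(\<Sum>A\<in>F. if ch xs A then w A else 0)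
      \<le> 1 + (\<Sum>e\<in>P. if ch xs (fst e) \<and> ch xs (snd e) then W e else 0)" for xs
  proof -
    let ?S = "{A \<in> F. ch xs A}"
    have "sum w ?S \<le> 1 + (\<Sum>(A, B) \<in> {(A, B). A \<in> ?S \<and> B \<in> ?S \<and> A \<subset> B}.
        if 2 * card A < n then w A else w B)"
    proof (rule chain_weight_le)
      fix A B assume "A \<in> ?S" "B \<in> ?S"
      then have "A = set (take (card A) xs)" "B = set (take (card B) xs)" by (auto simp: ch_def)
      then show "A \<subseteq> B \<or> B \<subseteq> A"
        by (metis nle_le set_take_subset_set_take)
    next
      fix A B assume "A \<in> ?S" "B \<in> ?S" "A \<subseteq> B" "2 * card B < n"
      moreover from this have "finite B" using F U finite_subset by blast
      ultimately show "2 * card A < n" using card_mono[of B A] by linarith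
    next
      fix A show "w A \<le> 1" using c binomial_maximum[of n "card A"] by (simp add: w_def c_def)
    next
      fix A assume "A \<in> ?S"
      then show "finite A" using F U finite_subset by blast
    qed (use finF c in \<open>auto simp: w_def\<close>)
    moreover have "{(A, B). A \<in> ?S \<and> B \<in> ?S \<and> A \<subset> B} = {e \<in> P. ch xs (fst e) \<and> ch xs (snd e)}"
      by (auto simp: P_def)
    ultimately show ?thesis
      using finF finP unfolding W_def by (simp add: sum.inter_filter)
  qed
  have single: "fact n / c \<le> (\<Sum>xs\<in>X. if ch xs A then w A else 0)" if "A \<in> F" for A
  proof -
    have "A \<subseteq> U" using that F by auto
    then have le: "card A \<le> n" using U by (simp add: n_def card_mono)
    have "fact n / c = w A * (fact (card A) * fact (n - card A))"
      using c binomial_fact[OF le, where 'a = real] by (simp add: w_def)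
    also have "\<dots> \<le> w A * real (card {xs \<in> X. ch xs A})"
    proof (rule mult_left_mono)
      show "fact (card A) * fact (n - card A) \<le> real (card {xs \<in> X. ch xs A})"
        using of_nat_mono[OF card_permutations_prefix[OF U(1) \<open>A \<subseteq> U\<close>], where 'a = real]
        by (simp add: n_def X_def ch_def)
    qed (use c in \<open>simp add: w_def\<close>)
    also have "\<dots> = (\<Sum>xs\<in>X. if ch xs A then w A else 0)"
      using finX by (simp add: sum.inter_filter[symmetric])
    finally show ?thesis .
  qed
  have pair: "(\<Sum>xs\<in>X. if ch xs (fst e) \<and> ch xs (snd e) then W e else 0) \<le> fact n / c * (2 / n)"
    if "e \<in> P" for e
  proof -
    obtain A B where e: "e = (A, B)" by fastforce
    have AB: "A \<subset> B" "B \<subset> U" using that F by (auto simp: e P_def)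
    then have fin: "finite B" using U finite_subset by auto
    have lt: "card A < card B" "card B < n"
      using AB U fin by (auto simp: n_def psubset_card_mono)
    have "(\<Sum>xs\<in>X. if ch xs (fst e) \<and> ch xs (snd e) then W e else 0)
        = W e * real (card {xs \<in> X. ch xs A \<and> ch xs B})"
      using finX by (simp add: sum.inter_filter[symmetric] e)
    also have "\<dots> \<le> W e * (fact (card A) * fact (card B - card A) * fact (n - card B))"
    proof (rule mult_left_mono)
      show "real (card {xs \<in> X. ch xs A \<and> ch xs B})
          \<le> fact (card A) * fact (card B - card A) * fact (n - card B)"
        using of_nat_mono[OF card_permutations_two_prefixes[OF U(1), of A B], where 'a = real] AB
        by (simp add: n_def X_def ch_def)
    qed (use c in \<open>simp add: W_def w_def e\<close>)
    also have "\<dots> \<le> fact n / c * (2 / n)"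
      using weight_times_pair_permutations_le[OF lt] unfolding W_def w_def e c_def prod.case .
    finally show ?thesis .
  qed
  have "card F * (fact n / c) \<le> (\<Sum>A\<in>F. \<Sum>xs\<in>X. if ch xs A then w A else 0)"
    using single by (rule sum_bounded_below)
  also have "\<dots> = (\<Sum>xs\<in>X. \<Sum>A\<in>F. if ch xs A then w A else 0)" by (rule sum.swap)
  also have "\<dots> \<le> (\<Sum>xs\<in>X. 1 + (\<Sum>e\<in>P. if ch xs (fst e) \<and> ch xs (snd e) then W e else 0))"
    by (intro sum_mono chain)
  also have "\<dots> = fact n + (\<Sum>xs\<in>X. \<Sum>e\<in>P. if ch xs (fst e) \<and> ch xs (snd e) then W e else 0)"
    by (simp add: sum.distrib cardX)
  also have "\<dots> = fact n + (\<Sum>e\<in>P. \<Sum>xs\<in>X. if ch xs (fst e) \<and> ch xs (snd e) then W e else 0)"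
    by (subst sum.swap) simp
  also have "\<dots> \<le> fact n + card P * (fact n / c * (2 / n))"
    using sum_bounded_above[of P, OF pair] by simp
  finally have "fact n * (card F / c) \<le> fact n * (1 + card P * (1 / c * (2 / n)))"
    by (simp add: algebra_simps)
  then have "card F / c \<le> 1 + card P * (1 / c * (2 / n))"
    by (subst (asm) mult_le_cancel_left_pos) auto
  then have "n * (card F - c) \<le> 2 * card P"
    using c n by (simp add: field_simps)
  then show ?thesis by (simp add: n_def c_def P_def)
qed

section \<open>Discarding vertices of small degree\<close>

text \<open>Deleting a vertex of degree below \<open>d\<close> loses fewer than \<open>d\<close>
  pairs. A set is counted separately as a lower and as an upper vertex, so there are at most
  \<open>2 * card F\<close> deletions.\<close>

lemma min_degree_subrelation:
  fixes E :: "('b \<times> 'b) set" and d :: nat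
  assumes "finite F" "E \<subseteq> F \<times> F"
  obtains E' where "E' \<subseteq> E" "card E \<le> card E' + 2 * d * card F"
    "\<And>A. A \<in> Domain E' \<Longrightarrow> d \<le> card (E' `` {A})"
    "\<And>B. B \<in> Range E' \<Longrightarrow> d \<le> card (E'\<inverse> `` {B})"
proof -
  \<comment> \<open>The invariant charges \<open>d\<close> lost pairs to each vertex that has left
    the domain or the range, written additively to avoid truncated subtraction. Deleting a vertex of
    small degree preserves it, so a smallest relation satisfying it has no such vertex.\<close>
  define ok where "ok D \<longleftrightarrow> D \<subseteq> E \<and>
    card E + d * (card (Domain D) + card (Range D)) \<le> card D + 2 * d * card F" for D
  have finE: "finite E" using assms finite_subset by blast
  have "card (Domain E) \<le> card F" "card (Range E) \<le> card F"
    using assms by (auto intro!: card_mono)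
  then have "d * (card (Domain E) + card (Range E)) \<le> d * (2 * card F)"
    by (intro mult_le_mono2) linarith
  then have "ok E" by (simp add: ok_def ac_simps)
  then obtain D where D: "ok D" and min: "\<And>D'. ok D' \<Longrightarrow> card D \<le> card D'"
    using ex_has_least_nat[of ok E card] by auto
  have finD: "finite D" using D finE finite_subset by (auto simp: ok_def)
  then have fins: "finite (Domain D)" "finite (Range D)"
    by (auto simp: finite_Domain finite_Range)
  have step: "\<not> ok D'" if "D' \<subset> D" for D'
    using min[of D'] psubset_card_mono[OF finD that] by auto
  show thesis
  proof
    show "D \<subseteq> E" "card E \<le> card D + 2 * d * card F" using D by (auto simp: ok_def)
  next
    fix A assume A: "A \<in> Domain D"
    show "d \<le> card (D `` {A})"
    proof (rule ccontr)
      assume small: "\<not> d \<le> card (D `` {A})"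
      let ?D = "D - {A} \<times> UNIV"
      have "card D = card ?D + card (D \<inter> {A} \<times> UNIV)"
        using card_Int_Diff[OF finD, of "{A} \<times> UNIV"] by simp
      moreover have "D \<inter> {A} \<times> UNIV = {A} \<times> D `` {A}" by auto
      then have "card (D \<inter> {A} \<times> UNIV) = card (D `` {A})" by (simp add: card_cartesian_product_singleton)
      moreover have "Domain ?D \<subseteq> Domain D - {A}" by auto
      then have "card (Domain ?D) \<le> card (Domain D - {A})" using fins by (intro card_mono) auto
      then have "card (Domain ?D) + 1 \<le> card (Domain D)"
        using card_Suc_Diff1[OF fins(1) A] by linarith
      moreover have "Range ?D \<subseteq> Range D" by auto
      then have "card (Range ?D) \<le> card (Range D)" using fins by (intro card_mono) auto
      ultimately have c: "card D = card ?D + card (D `` {A})"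
        "card (Domain ?D) + card (Range ?D) + 1 \<le> card (Domain D) + card (Range D)" by linarith+
      have "d * (card (Domain ?D) + card (Range ?D) + 1) \<le> d * (card (Domain D) + card (Range D))"
        by (rule mult_le_mono2[OF c(2)])
      then have "ok ?D" using D c(1) small by (auto simp: ok_def algebra_simps)
      moreover have "?D \<subset> D" using A by auto
      ultimately show False using step by blast
    qed
  next
    fix B assume B: "B \<in> Range D"
    show "d \<le> card (D\<inverse> `` {B})"
    proof (rule ccontr)
      assume small: "\<not> d \<le> card (D\<inverse> `` {B})"
      let ?D = "D - UNIV \<times> {B}"
      have "card D = card ?D + card (D \<inter> UNIV \<times> {B})"
        using card_Int_Diff[OF finD, of "UNIV \<times> {B}"] by simp
      moreover have "D \<inter> UNIV \<times> {B} = (D\<inverse> `` {B}) \<times> {B}" by auto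
      then have "card (D \<inter> UNIV \<times> {B}) = card (D\<inverse> `` {B})" by (simp add: card_cartesian_product)
      moreover have "Range ?D \<subseteq> Range D - {B}" by auto
      then have "card (Range ?D) \<le> card (Range D - {B})" using fins by (intro card_mono) auto
      then have "card (Range ?D) + 1 \<le> card (Range D)"
        using card_Suc_Diff1[OF fins(2) B] by linarith
      moreover have "Domain ?D \<subseteq> Domain D" by auto
      then have "card (Domain ?D) \<le> card (Domain D)" using fins by (intro card_mono) auto
      ultimately have c: "card D = card ?D + card (D\<inverse> `` {B})"
        "card (Domain ?D) + card (Range ?D) + 1 \<le> card (Domain D) + card (Range D)" by linarith+
      have "d * (card (Domain ?D) + card (Range ?D) + 1) \<le> d * (card (Domain D) + card (Range D))"
        by (rule mult_le_mono2[OF c(2)])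
      then have "ok ?D" using D c(1) small by (auto simp: ok_def algebra_simps)
      moreover have "?D \<subset> D" using B by auto
      ultimately show False using step by blast
    qed
  qed
qed

section \<open>Greedy embedding of trees built leaf by leaf\<close>

text \<open>The last premise of \<open>attach\<close> makes \<open>v\<close> a leaf of the enlarged
  graph. Starting from an edge instead of a vertex gives every element present a neighbour that is
  also present, so its role as lower or upper element is already fixed when a leaf is attached to
  it.\<close>

inductive grown :: "'a rel \<Rightarrow> 'a set \<Rightarrow> bool" for R where
  edge: "(p, q) \<in> R \<Longrightarrow> p \<noteq> q \<Longrightarrow> grown R {p, q}"
| attach: "grown R S \<Longrightarrow> v \<notin> S \<Longrightarrow> u \<in> S \<Longrightarrow> (u, v) \<in> R \<union> R\<inverse>
    \<Longrightarrow> (\<And>u'. u' \<in> S \<Longrightarrow> (u', v) \<in> R \<union> R\<inverse> \<Longrightarrow> u' = u) \<Longrightarrow> grown R (insert v S)"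

lemma grown_finite: "grown R S \<Longrightarrow> finite S"
  by (induction rule: grown.induct) (blast intro: finite.intros)+

lemma grown_card_ge_2: "grown R S \<Longrightarrow> 2 \<le> card S"
proof (induction rule: grown.induct)
  case (attach S v u)
  then have "card (insert v S) = Suc (card S)"
    by (intro card_insert_disjoint grown_finite)
  then show ?case using attach.IH by linarith
qed simp

lemma grown_incident:
  "grown R S \<Longrightarrow> u \<in> S \<Longrightarrow> \<exists>u'\<in>S. (u, u') \<in> R \<union> R\<inverse>"
  by (induction arbitrary: u rule: grown.induct) blast+

text \<open>Extensional functions make an embedding determined by its values on \<open>S\<close>, so
  that embeddings can be counted.\<close>

definition rel_embeddings :: "'a rel \<Rightarrow> 'b rel \<Rightarrow> 'a set \<Rightarrow> ('a \<Rightarrow> 'b) set" where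
  "rel_embeddings R E S = {f \<in> S \<rightarrow>\<^sub>E Field E. inj_on f S \<and>
     (\<forall>p\<in>S. \<forall>q\<in>S. (p, q) \<in> R \<longrightarrow> (f p, f q) \<in> E)}"

lemma finite_rel_embeddings:
  "finite E \<Longrightarrow> finite S \<Longrightarrow> finite (rel_embeddings R E S)"
  unfolding rel_embeddings_def
  by (rule finite_subset[of _ "S \<rightarrow>\<^sub>E Field E"]) (auto intro: finite_PiE simp: finite_Field)

text \<open>The initial edge can be sent to any pair of \<open>E\<close>. Each of the
  \<open>card S - 2\<close> later elements then has at least \<open>d\<close> candidates, fewer than
  \<open>N\<close> of which are occupied, so at least \<open>m\<close> remain.\<close>

lemma card_rel_embeddings_grown:
  fixes E :: "'b rel" and d m N :: nat
  assumes "finite E" and irr: "\<And>A. (A, A) \<notin> E"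
    and bip: "\<And>p q s. (p, q) \<in> R \<Longrightarrow> (q, s) \<notin> R"
    and out: "\<And>A. A \<in> Domain E \<Longrightarrow> d \<le> card (E `` {A})"
    and into: "\<And>B. B \<in> Range E \<Longrightarrow> d \<le> card (E\<inverse> `` {B})"
    and d: "m + N \<le> d"
    and "grown R S" "card S \<le> N"
  shows "card E * m ^ (card S - 2) \<le> card (rel_embeddings R E S)"
  using assms(7,8)
proof (induction rule: grown.induct)
  case (edge p q)
  define h where "h = (\<lambda>(A, B). (\<lambda>x\<in>{p, q}. if x = p then A else B) :: 'a \<Rightarrow> 'b)"
  have "inj_on h E"
  proof (rule inj_onI)
    fix x y assume "h x = h y"
    then have "h x p = h y p" "h x q = h y q" by auto
    then show "x = y" using edge by (auto simp: h_def split: prod.splits)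
  qed
  moreover have "h ` E \<subseteq> rel_embeddings R E {p, q}"
  proof clarify
    fix A B assume AB: "(A, B) \<in> E"
    have "A \<noteq> B" using AB irr by auto
    moreover have "(q, p) \<notin> R" "(p, p) \<notin> R" "(q, q) \<notin> R" using bip edge by blast+
    ultimately show "h (A, B) \<in> rel_embeddings R E {p, q}"
      using AB edge by (auto simp: rel_embeddings_def h_def inj_on_def Field_def)
  qed
  ultimately have "card E \<le> card (rel_embeddings R E {p, q})"
    using finite_rel_embeddings[OF assms(1), of "{p, q}"] by (intro card_inj_on_le) auto
  then show ?case using edge by simp
next
  case (attach S v u)
  have finS: "finite S" using attach.hyps(1) grown_finite by blast
  have cS: "card (insert v S) = Suc (card S)" "2 \<le> card S"
    using attach.hyps(1,2) finS grown_card_ge_2 by auto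
  \<comment> \<open>These are the candidate images of \<open>v\<close> when \<open>u\<close> is sent
    to \<open>A\<close>; the side of \<open>E\<close> depends on the direction of the arc joining
    \<open>u\<close> and \<open>v\<close>.\<close>
  define nb where "nb A = (if (u, v) \<in> R then E `` {A} else E\<inverse> `` {A})" for A
  have finnb: "finite (nb A)" for A
    using assms(1) by (auto simp: nb_def Image_def intro: finite_subset[OF _ finite_Range] finite_subset[OF _ finite_Domain])
  define J where "J = (SIGMA f : rel_embeddings R E S. nb (f u) - f ` S)"
  define g where "g = (\<lambda>(f, y). f(v := y) :: 'a \<Rightarrow> 'b)"
  \<comment> \<open>By \<open>bip\<close>, \<open>u\<close> is lower or upper with respect to
    \<open>v\<close> exactly as it is with respect to \<open>u'\<close>. The image of the arc
    joining \<open>u\<close> and \<open>u'\<close> therefore puts \<open>f u\<close> on the side of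
    \<open>E\<close> where the degree bound is required.\<close>
  obtain u' where u': "u' \<in> S" "(u, u') \<in> R \<union> R\<inverse>" using grown_incident[OF attach.hyps(1,3)] by blast
  have large: "m \<le> card (nb (f u) - f ` S)" if f: "f \<in> rel_embeddings R E S" for f
  proof -
    have "d \<le> card (nb (f u))"
    proof (cases "(u, v) \<in> R")
      case True
      then have "(u, u') \<in> R" using u' bip by blast
      then have "(f u, f u') \<in> E" using f u' attach.hyps(3) by (auto simp: rel_embeddings_def)
      then show ?thesis using out True by (auto simp: nb_def)
    next
      case False
      then have "(u', u) \<in> R" using attach.hyps(4) u'(2) bip by blast
      then have "(f u', f u) \<in> E" using f u' attach.hyps(3) by (auto simp: rel_embeddings_def)
      then show ?thesis using into False by (auto simp: nb_def)
    qed
    moreover have "card (f ` S) \<le> card S" by (rule card_image_le[OF finS])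
    moreover have "card (nb (f u)) - card (f ` S) \<le> card (nb (f u) - f ` S)"
      using finS by (intro diff_card_le_card_Diff) auto
    ultimately show ?thesis using d attach.prems cS by linarith
  qed
  have "inj_on g J"
  proof (rule inj_onI)
    fix x y assume x: "x \<in> J" and y: "y \<in> J" and eq: "g x = g y"
    obtain f a f' b where xy: "x = (f, a)" "y = (f', b)" by fastforce
    \<comment> \<open>Outside \<open>S\<close> both maps take the default value, in particular at
      \<open>v\<close>, so the update at \<open>v\<close> can be undone.\<close>
    have "f \<in> extensional S" "f' \<in> extensional S"
      using x y by (auto simp: J_def xy rel_embeddings_def PiE_def)
    then have "f v = f' v" using attach.hyps(2) by (auto simp: extensional_def)
    moreover have "f(v := a) = f'(v := b)" using eq by (simp add: g_def xy)
    ultimately have "f = f'" "a = b" by (metis fun_upd_triv fun_upd_upd, metis fun_upd_same)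
    then show "x = y" by (simp add: xy)
  qed
  moreover have "g ` J \<subseteq> rel_embeddings R E (insert v S)"
  proof clarify
    fix f y assume "(f, y) \<in> J"
    then have f: "f \<in> rel_embeddings R E S" and y: "y \<in> nb (f u)" "y \<notin> f ` S" by (auto simp: J_def)
    have fE: "f \<in> S \<rightarrow>\<^sub>E Field E" and inj: "inj_on f S"
      and hom: "\<And>p q. p \<in> S \<Longrightarrow> q \<in> S \<Longrightarrow> (p, q) \<in> R \<Longrightarrow> (f p, f q) \<in> E"
      using f by (auto simp: rel_embeddings_def)
    have yF: "y \<in> Field E" using y by (auto simp: nb_def Field_def split: if_splits)
    have "(v, v) \<notin> R" using bip by blast
    have vp: "((f(v := y)) p, (f(v := y)) q) \<in> E"
      if pq: "p \<in> insert v S" "q \<in> insert v S" "(p, q) \<in> R" for p q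
    proof -
      consider "p = v" "q \<in> S" | "q = v" "p \<in> S" | "p \<in> S" "q \<in> S"
        using pq \<open>(v, v) \<notin> R\<close> by blast
      then show ?thesis
      proof cases
        case 1
        have "q = u" using attach.hyps(5)[of q] pq(3) 1 by blast
        have "(u, v) \<notin> R" using bip pq(3) 1 \<open>q = u\<close> by blast
        then show ?thesis using 1 \<open>q = u\<close> y attach.hyps(2) by (auto simp: nb_def)
      next
        case 2
        have "p = u" using attach.hyps(5)[of p] pq(3) 2 by blast
        then show ?thesis using 2 y attach.hyps(2) pq(3) by (auto simp: nb_def)
      next
        case 3
        then show ?thesis using hom pq(3) attach.hyps(2) by auto
      qed
    qed
    have "inj_on (f(v := y)) (insert v S)"
      using inj y attach.hyps(2) by (auto simp: inj_on_def)
    moreover have "f(v := y) \<in> insert v S \<rightarrow>\<^sub>E Field E"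
      using fE yF by (auto simp: PiE_def extensional_def)
    ultimately show "g (f, y) \<in> rel_embeddings R E (insert v S)"
      using vp by (simp add: rel_embeddings_def g_def del: fun_upd_apply)
  qed
  ultimately have "card J \<le> card (rel_embeddings R E (insert v S))"
    using finite_rel_embeddings[OF assms(1), of "insert v S"] finS by (intro card_inj_on_le) auto
  moreover have "card (rel_embeddings R E S) * m \<le> card J"
  proof -
    have "card J = (\<Sum>f\<in>rel_embeddings R E S. card (nb (f u) - f ` S))"
      unfolding J_def using finite_rel_embeddings[OF assms(1) finS] finnb by (intro card_SigmaI) auto
    also have "\<dots> \<ge> of_nat (card (rel_embeddings R E S)) * m"
      by (rule sum_bounded_below) (use large in auto)
    finally show ?thesis by simp
  qed
  moreover have "card E * m ^ (card S - 2) * m \<le> card (rel_embeddings R E S) * m"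
    using attach.IH attach.prems cS by (intro mult_le_mono1) auto
  moreover have "card E * m ^ (card (insert v S) - 2) = card E * m ^ (card S - 2) * m"
  proof -
    have "card (insert v S) - 2 = Suc (card S - 2)" using cS by linarith
    then show ?thesis by simp
  qed
  ultimately show ?case by linarith
qed

section \<open>Undirected trees are grown leaf by leaf\<close>

text \<open>A path among the old elements that ends at the neighbour of the new leaf extends to the
  leaf. Such paths are closed into undirected cycles below.\<close>

lemma grown_path:
  assumes "grown R S" "u \<in> S" "w \<in> S"
  shows "\<exists>xs. xs \<noteq> [] \<and> hd xs = u \<and> last xs = w \<and> distinct xs \<and> set xs \<subseteq> S \<and>
    successively (\<lambda>a b. (a, b) \<in> R \<union> R\<inverse>) xs"
  using assms
proof (induction arbitrary: u w rule: grown.induct)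
  case (edge p q)
  show ?case
  proof (cases "u = w")
    case True
    then show ?thesis using edge.prems by (intro exI[of _ "[u]"]) simp
  next
    case False
    then have "(u, w) \<in> R \<union> R\<inverse>" using edge by blast
    then show ?thesis using False edge.prems by (intro exI[of _ "[u, w]"]) simp
  qed
next
  case (attach S v s)
  consider "u = v" "w = v" | "u = v" "w \<in> S" | "u \<in> S" "w = v" | "u \<in> S" "w \<in> S"
    using attach.prems by blast
  then show ?case
  proof cases
    case 1
    then show ?thesis by (intro exI[of _ "[v]"]) auto
  next
    case 2
    obtain xs where xs: "xs \<noteq> []" "hd xs = s" "last xs = w" "distinct xs" "set xs \<subseteq> S"
      "successively (\<lambda>a b. (a, b) \<in> R \<union> R\<inverse>) xs"
      using attach.IH[OF attach.hyps(3) 2(2)] by blast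
    then show ?thesis using attach.hyps(2,4) 2
      by (intro exI[of _ "v # xs"]) (auto simp: successively_Cons)
  next
    case 3
    obtain xs where xs: "xs \<noteq> []" "hd xs = u" "last xs = s" "distinct xs" "set xs \<subseteq> S"
      "successively (\<lambda>a b. (a, b) \<in> R \<union> R\<inverse>) xs"
      using attach.IH[OF 3(1) attach.hyps(3)] by blast
    then show ?thesis using attach.hyps(2,4) 3
      by (intro exI[of _ "xs @ [v]"]) (auto simp: successively_append_iff)
  next
    case 4
    then show ?thesis using attach.IH[OF 4] by blast
  qed
qed

text \<open>Library walks are lists of arcs, and arcs here are pairs of vertices, so a vertex list
  becomes a walk by zipping it with its own tail.\<close>

lemma awalk_zip:
  assumes "successively (\<lambda>a b. (a, b) \<in> parcs H) (x # xs)" "x \<in> pverts H"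
  shows "pre_digraph.awalk (with_proj H) x (zip (x # xs) xs) (last (x # xs))"
    and "pre_digraph.awalk_verts (with_proj H) x (zip (x # xs) xs) = x # xs"
proof -
  have "set (zip (x # xs) xs) \<subseteq> parcs H \<and> pcas x (zip (x # xs) xs) (last (x # xs)) \<and>
      pawalk_verts x (zip (x # xs) xs) = x # xs"
    using assms(1) by (induction xs arbitrary: x) auto
  then show "pre_digraph.awalk (with_proj H) x (zip (x # xs) xs) (last (x # xs))"
    "pre_digraph.awalk_verts (with_proj H) x (zip (x # xs) xs) = x # xs"
    using assms(2) by (auto simp: pre_digraph.awalk_def cas_with_proj_eq awalk_verts_with_proj_eq)
qed

lemma parcs_mk_symmetric_with_proj:
  "parcs (mk_symmetric (with_proj D)) = parcs D \<union> (parcs D)\<inverse>"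
  by (auto simp: mk_symmetric_def)

text \<open>Two distinct neighbours of \<open>v\<close> in \<open>S\<close> are joined by a path
  inside \<open>S\<close>, which \<open>v\<close> closes to an undirected cycle.\<close>

lemma underlying_tree_unique_neighbour:
  assumes tree: "underlying_tree D" and S: "grown (parcs D) S"
    and v: "v \<in> pverts D" "v \<notin> S"
    and u: "u \<in> S" "(u, v) \<in> parcs D \<union> (parcs D)\<inverse>"
    and u': "u' \<in> S" "(u', v) \<in> parcs D \<union> (parcs D)\<inverse>"
  shows "u' = u"
proof (rule ccontr)
  assume neq: "u' \<noteq> u"
  let ?H = "mk_symmetric (with_proj D)"
  obtain xs where xs: "xs \<noteq> []" "hd xs = u" "last xs = u'" "distinct xs" "set xs \<subseteq> S"
    "successively (\<lambda>a b. (a, b) \<in> parcs D \<union> (parcs D)\<inverse>) xs"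
    using grown_path[OF S u(1) u'(1)] by blast
  \<comment> \<open>The cycle has one arc more than \<open>xs\<close> has vertices. As
    \<open>xs\<close> joins distinct vertices, that makes at least 3 arcs, which excludes walking
    back and forth along one edge.\<close>
  let ?c = "zip (v # xs @ [v]) (xs @ [v])"
  have succ: "successively (\<lambda>a b. (a, b) \<in> parcs ?H) (v # xs @ [v])"
    using xs u(2) u'(2)
    by (auto simp: parcs_mk_symmetric_with_proj successively_Cons successively_append_iff)
  have "pre_digraph.cycle (with_proj ?H) ?c"
    unfolding pre_digraph.cycle_def
    using awalk_zip[OF succ] xs v by (intro exI[of _ v]) auto
  moreover have "length xs \<ge> 2"
  proof -
    have "length xs \<noteq> 1" using xs(2,3) neq by (auto simp: length_Suc_conv)
    moreover have "length xs \<noteq> 0" using xs(1) by simp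
    ultimately show ?thesis by linarith
  qed
  then have "3 \<le> length ?c" by simp
  ultimately show False using tree unfolding underlying_tree_def by blast
qed

text \<open>A largest grown vertex set is closed under adjacency, because any outside neighbour
  could be attached as a leaf. By connectedness it contains every vertex.\<close>

lemma underlying_tree_grown:
  assumes tree: "underlying_tree D" and fin: "finite (pverts D)"
    and arcs: "parcs D \<subseteq> pverts D \<times> pverts D" and e: "(p, q) \<in> parcs D" "p \<noteq> q"
  shows "grown (parcs D) (pverts D)"
proof -
  define ok where "ok S \<longleftrightarrow> grown (parcs D) S \<and> S \<subseteq> pverts D" for S
  have ok0: "ok {p, q}" using e arcs by (auto simp: ok_def intro: grown.edge)
  have "card S < card (pverts D) + 1" if "ok S" for S
    using that fin by (simp add: ok_def card_mono less_Suc_eq_le)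
  then obtain S where S: "ok S" and max: "\<And>S'. ok S' \<Longrightarrow> card S' \<le> card S"
    using ex_has_greatest_nat[of ok, OF ok0, of card "card (pverts D) + 1"] by auto
  have S': "grown (parcs D) S" "S \<subseteq> pverts D" using S by (auto simp: ok_def)
  have closed: "b \<in> S" if "a \<in> S" "(a, b) \<in> parcs D \<union> (parcs D)\<inverse>" for a b
  proof (rule ccontr)
    assume b: "b \<notin> S"
    have bD: "b \<in> pverts D" using that(2) arcs by auto
    have "grown (parcs D) (insert b S)"
      using underlying_tree_unique_neighbour[OF tree S'(1) bD b that]
      by (intro grown.attach[OF S'(1) b that]) auto
    then have "ok (insert b S)" using S' bD by (simp add: ok_def)
    then have "card (insert b S) \<le> card S" by (rule max)
    then show False using b S' fin finite_subset by fastforce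
  qed
  obtain a where a: "a \<in> S" using grown_card_ge_2[OF S'(1)] by fastforce
  have "pverts D \<subseteq> S"
  proof
    fix b assume "b \<in> pverts D"
    then have "a \<rightarrow>\<^sup>*\<^bsub>with_proj (mk_symmetric (with_proj D))\<^esub> b"
      using tree a S'(2)
      by (auto simp: underlying_tree_def Digraph_Component.connected_def strongly_connected_def)
    then have "(a, b) \<in> rtrancl_on (pverts D) (parcs D \<union> (parcs D)\<inverse>)"
      by (simp add: reachable_def parcs_mk_symmetric_with_proj)
    then show "b \<in> S" using a
      by (induction rule: rtrancl_on.induct) (use closed in blast)+
  qed
  then show ?thesis using S' by (simp add: subset_antisym)
qed

section \<open>Posets of height 2, and passing from embeddings to copies\<close>

text \<open>Two consecutive strict relations would form a chain of size 3, while a chain of size 2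
  attains the maximum. The first conclusion makes every strict relation a Hasse arc and forbids an
  element from being both lower and upper.\<close>

lemma height_2_posetD:
  assumes "finite T" and po: "partial_order_on T r" and height: "poset_height T r = 2"
  shows "\<And>p z q. p \<in> T \<Longrightarrow> z \<in> T \<Longrightarrow> q \<in> T \<Longrightarrow> (p, z) \<in> r \<Longrightarrow> p \<noteq> z \<Longrightarrow> (z, q) \<in> r \<Longrightarrow> z = q"
    and "\<exists>p\<in>T. \<exists>q\<in>T. (p, q) \<in> r \<and> p \<noteq> q"
proof -
  define M where "M = {card C | C. C \<subseteq> T \<and> C \<in> Chains r}"
  have "M \<subseteq> {..card T}" using assms(1) by (auto simp: M_def intro: card_mono)
  then have finM: "finite M" by (rule finite_subset) simp
  \<comment> \<open>The empty chain makes \<open>M\<close> nonempty, so that \<open>Max M\<close> is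
    attained.\<close>
  have "card ({} :: 'a set) \<in> M" unfolding M_def by (intro CollectI exI[of _ "{}"]) (simp add: Chains_def)
  then have ne: "M \<noteq> {}" by auto
  have Max: "Max M = 2" using height by (simp add: poset_height_def M_def)
  have refl: "\<And>x. x \<in> T \<Longrightarrow> (x, x) \<in> r" and "trans r" and "antisym r"
    using po by (auto simp: partial_order_on_def preorder_on_def refl_on_def)
  show "z = q" if "p \<in> T" "z \<in> T" "q \<in> T" "(p, z) \<in> r" "p \<noteq> z" "(z, q) \<in> r" for p z q
  proof (rule ccontr)
    assume "z \<noteq> q"
    have "(p, q) \<in> r" using \<open>trans r\<close> that by (meson transD)
    moreover have "p \<noteq> q" using \<open>antisym r\<close> that by (meson antisymD)
    ultimately have "card {p, z, q} = 3" "{p, z, q} \<in> Chains r"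
      using that \<open>z \<noteq> q\<close> refl by (auto simp: Chains_def)
    then have "3 \<in> M" unfolding M_def using that by (auto intro!: exI[of _ "{p, z, q}"])
    then have "3 \<le> Max M" using finM by simp
    then show False using Max by simp
  qed
  obtain C where C: "C \<subseteq> T" "C \<in> Chains r" "card C = 2"
    using Max_in[OF finM ne] unfolding Max by (auto simp: M_def)
  then obtain p q where "C = {p, q}" "p \<noteq> q" by (auto simp: card_2_iff)
  then show "\<exists>p\<in>T. \<exists>q\<in>T. (p, q) \<in> r \<and> p \<noteq> q" using C by (auto simp: Chains_def)
qed

text \<open>The image of an embedding is a copy, and a given copy is the image of at most
  \<open>card T ^ card T\<close> maps. This factor is the price of counting subfamilies instead of
  maps.\<close>

lemma card_rel_embeddings_le_poset_copies:
  assumes "finite T" "finite \<F>"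
    and R: "\<And>p q. p \<in> T \<Longrightarrow> q \<in> T \<Longrightarrow> (p, q) \<in> r \<Longrightarrow> p \<noteq> q \<Longrightarrow> (p, q) \<in> R"
    and E: "E \<subseteq> {(A, B). A \<in> \<F> \<and> B \<in> \<F> \<and> A \<subset> B}"
  shows "card (rel_embeddings R E T) \<le> card (poset_copies T r \<F>) * card T ^ card T"
proof -
  let ?K = "poset_copies T r \<F>"
  have finK: "finite ?K"
    by (rule finite_subset[of _ "Pow \<F>"]) (use assms(2) in \<open>auto simp: poset_copies_def\<close>)
  have G: "finite \<G>" "card \<G> = card T" if "\<G> \<in> ?K" for \<G>
    using that assms(1,2) by (auto simp: poset_copies_def bij_betw_same_card intro: finite_subset)
  have "rel_embeddings R E T \<subseteq> (\<Union>\<G>\<in>?K. T \<rightarrow>\<^sub>E \<G>)"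
  proof
    fix f assume f: "f \<in> rel_embeddings R E T"
    have "Field E \<subseteq> \<F>" using E by (auto simp: Field_def)
    then have "f ` T \<subseteq> \<F>" using f by (auto simp: rel_embeddings_def)
    moreover have "bij_betw f T (f ` T)" using f by (auto simp: rel_embeddings_def bij_betw_def)
    moreover have "f p \<subseteq> f q" if "p \<in> T" "q \<in> T" "(p, q) \<in> r" for p q
    proof (cases "p = q")
      case False
      then have "(f p, f q) \<in> E" using f R that by (auto simp: rel_embeddings_def)
      then show ?thesis using E by auto
    qed simp
    ultimately have "f ` T \<in> ?K"
      unfolding poset_copies_def by (intro CollectI conjI exI[of _ f]) auto
    moreover have "f \<in> T \<rightarrow>\<^sub>E f ` T" using f by (auto simp: rel_embeddings_def)
    ultimately show "f \<in> (\<Union>\<G>\<in>?K. T \<rightarrow>\<^sub>E \<G>)" by blast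
  qed
  then have "card (rel_embeddings R E T) \<le> card (\<Union>\<G>\<in>?K. T \<rightarrow>\<^sub>E \<G>)"
    using finK assms(1) G by (intro card_mono) (auto intro: finite_PiE)
  also have "\<dots> \<le> (\<Sum>\<G>\<in>?K. card (T \<rightarrow>\<^sub>E \<G>))" by (rule card_UN_le[OF finK])
  also have "\<dots> = (\<Sum>\<G>\<in>?K. card T ^ card T)"
    using assms(1) G by (intro sum.cong) (auto simp: card_PiE)
  finally show ?thesis by simp
qed

section \<open>Choice of constants and conclusion\<close>

theorem theorem1p5:
  fixes T :: "'a set" and r :: "'a rel" and t :: nat and \<epsilon> :: real
  assumes "finite T"
    and "partial_order_on T r"
    and "tree_poset T r"
    and "poset_height T r = 2"
    and "card T = t + 1"
    and "\<epsilon> > 0"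
  shows "\<exists>\<delta>::real. \<delta> > 0 \<and> (\<exists>n\<^sub>0::nat. \<forall>n\<ge>n\<^sub>0. \<forall>\<F>::nat set set.
           \<F> \<subseteq> Pow {1..n} \<and>
           real (card \<F>) \<ge> (1 + \<epsilon>) * real (n choose (n div 2)) \<longrightarrow>
           real (card (poset_copies T r \<F>)) \<ge> \<delta> * real n ^ t * real (n choose (n div 2)))"
proof -
  define R where "R = parcs (hasse_diagram T r)"
  \<comment> \<open>With \<open>d\<close> at most 2an and at most (1 + \<epsilon>)c sets, the degree
    cleaning loses at most 4a(1 + \<epsilon>)nc = \<epsilon>nc/8 pairs, half of the \<epsilon>nc/4
    guaranteed.\<close>
  define a where "a = \<epsilon> / (32 * (1 + \<epsilon>))"
  \<comment> \<open>The factors come from the surviving pairs, the \<open>t - 1\<close> greedy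
    choices of at least an sets each, and the maps sharing one copy.\<close>
  define \<delta> where "\<delta> = \<epsilon> / 8 * a ^ (t - 1) / real (t + 1) ^ (t + 1)"
  have a: "a > 0" "4 * a * (1 + \<epsilon>) = \<epsilon> / 8" using assms(6) by (auto simp: a_def field_simps)
  have h3: "z = q" if "p \<in> T" "z \<in> T" "q \<in> T" "(p, z) \<in> r" "p \<noteq> z" "(z, q) \<in> r" for p z q
    using height_2_posetD(1)[OF assms(1,2,4)] that by blast
  have R_iff: "(p, q) \<in> R \<longleftrightarrow> p \<in> T \<and> q \<in> T \<and> (p, q) \<in> r \<and> p \<noteq> q" for p q
    using h3 by (auto simp: R_def hasse_diagram_def)
  have bip: "(q, s) \<notin> R" if "(p, q) \<in> R" for p q s
    using that h3 by (auto simp: R_iff)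
  obtain p q where "(p, q) \<in> R" "p \<noteq> q"
    using height_2_posetD(2)[OF assms(1,2,4)] R_iff by blast
  then have grown: "grown R T"
    using underlying_tree_grown[of "hasse_diagram T r" p q] assms(1,3)
    by (auto simp: tree_poset_def R_def hasse_diagram_def)
  then have t: "t \<ge> 1" using grown_card_ge_2 assms(5) by fastforce
  \<comment> \<open>The first term serves \<open>le_binomial\<close>, the second gives \<epsilon>c
    \<ge> 4 to absorb rounding and the loss of the full set, and the third gives an \<ge> t + 2 to
    absorb the floor in \<open>d\<close> and the \<open>t + 1\<close> occupied images.\<close>
  obtain n0 :: nat where n0: "2 + 4 / \<epsilon> + (t + 2) / a < n0" using reals_Archimedean2 by blast
  have "\<delta> * real n ^ t * real (n choose (n div 2)) \<le> real (card (poset_copies T r \<F>))"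
    if "n \<ge> n0" and F: "\<F> \<subseteq> Pow {1..n}"
      and big: "(1 + \<epsilon>) * real (n choose (n div 2)) \<le> real (card \<F>)" for n :: nat and \<F> :: "nat set set"
  proof -
    define c where "c = real (n choose (n div 2))"
    have "real n0 \<le> real n" using that(1) by simp
    moreover have "0 \<le> 4 / \<epsilon>" "0 \<le> (t + 2) / a" using assms(6) a by auto
    ultimately have n: "real n \<ge> 2" "4 / \<epsilon> \<le> n" "(t + 2) / a \<le> n" using n0 by linarith+
    have n_large: "4 \<le> \<epsilon> * n" "t + 2 \<le> a * n"
      using n assms(6) a by (auto simp: field_simps)
    have "n \<le> n choose (n div 2)" using n(1) by (intro le_binomial) auto
    then have c: "real n \<le> c" by (simp add: c_def)
    then have "\<epsilon> * n \<le> \<epsilon> * c" using assms(6) by simp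
    then have \<epsilon>c: "4 \<le> \<epsilon> * c" using n_large by linarith
    have finF: "finite \<F>" using F by (rule finite_subset) simp
    \<comment> \<open>The loss in the degree cleaning grows with the family, and \<open>\<F>\<close>
      may be far larger than \<open>c\<close>, so a subfamily of size about (1 + \<epsilon>/2)c is
      used. The other \<epsilon>/2 leaves room for rounding up and for removing
      \<open>{1..n}\<close>.\<close>
    define N where "N = nat \<lceil>(1 + \<epsilon> / 2) * c\<rceil>"
    have "0 \<le> (1 + \<epsilon> / 2) * c" using assms(6) c by simp
    then have N: "(1 + \<epsilon> / 2) * c \<le> N" "N \<le> (1 + \<epsilon> / 2) * c + 1"
      unfolding N_def by linarith+
    have N_le: "real N + 1 \<le> (1 + \<epsilon>) * c"
      using N(2) \<epsilon>c by (simp add: algebra_simps)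
    then have "real N + 1 \<le> card \<F>" using big by (simp add: c_def)
    moreover have "card \<F> \<le> card (\<F> - {{1..n}}) + 1"
      using finF by (cases "{1..n} \<in> \<F>") (simp_all add: card_Diff_singleton)
    ultimately have "N \<le> card (\<F> - {{1..n}})" by linarith
    then obtain F0 where F0: "F0 \<subseteq> \<F> - {{1..n}}" "card F0 = N" "finite F0"
      using obtain_subset_with_card_n by metis
    define E where "E = {(A, B). A \<in> F0 \<and> B \<in> F0 \<and> A \<subset> B}"
    have E_sub: "E \<subseteq> F0 \<times> F0" by (auto simp: E_def)
    have "real n * (real N - c) \<le> 2 * real (card E)"
      using comparable_pairs_lower_bound[of "{1..n}" F0] F F0 n(1)
      by (auto simp: E_def c_def)
    moreover have "real n * (\<epsilon> / 2 * c) \<le> real n * (real N - c)"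
      using N(1) by (intro mult_left_mono) (auto simp: algebra_simps)
    ultimately have cardE: "\<epsilon> * n * c / 4 \<le> card E" by (simp add: algebra_simps)
    define d where "d = nat \<lfloor>2 * a * n\<rfloor>"
    have "0 \<le> 2 * a * n" using a by simp
    then have d: "2 * a * n - 1 \<le> d" "d \<le> 2 * a * n" unfolding d_def by linarith+
    \<comment> \<open>At least 2an - 1 - (t + 1) \<ge> an choices remain after setting aside
      \<open>t + 1\<close> occupied images.\<close>
    define m where "m = d - (t + 1)"
    have "real (t + 1) \<le> d" using d(1) n_large(2) by simp
    then have md: "m + (t + 1) = d" by (simp add: m_def)
    then have m: "a * n \<le> m" using d(1) n_large(2) by linarith
    obtain E' where E': "E' \<subseteq> E" "card E \<le> card E' + 2 * d * card F0"
      and out: "\<And>A. A \<in> Domain E' \<Longrightarrow> d \<le> card (E' `` {A})"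
      and into: "\<And>B. B \<in> Range E' \<Longrightarrow> d \<le> card (E'\<inverse> `` {B})"
      using min_degree_subrelation[OF F0(3) E_sub] by metis
    have finE': "finite E'" using E'(1) E_sub F0(3) by (meson finite_SigmaI finite_subset)
    have "real d * N \<le> (2 * a * n) * ((1 + \<epsilon>) * c)"
      using d(2) N_le a by (intro mult_mono) auto
    also have "\<dots> = (4 * a * (1 + \<epsilon>)) * n * c / 2" by simp
    also have "\<dots> = \<epsilon> * n * c / 16" unfolding a(2) by simp
    finally have dN: "real d * N \<le> \<epsilon> * n * c / 16" .
    have "real (card E) \<le> card E' + 2 * (real d * N)"
      using of_nat_mono[OF E'(2), where 'a = real] by (simp add: F0(2))
    then have cardE': "\<epsilon> * n * c / 8 \<le> card E'" using cardE dN by linarith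
    have "card E' * m ^ (card T - 2) \<le> card (rel_embeddings R E' T)"
    proof (rule card_rel_embeddings_grown[where d = d and N = "t + 1"])
      show "(A, A) \<notin> E'" for A using E'(1) by (auto simp: E_def)
    qed (use finE' bip out into grown md assms(5) in simp_all)
    also have "\<dots> \<le> card (poset_copies T r \<F>) * card T ^ card T"
      using E'(1) F0(1) by (intro card_rel_embeddings_le_poset_copies assms(1) finF) (auto simp: R_iff E_def)
    finally have "card E' * m ^ (t - 1) \<le> card (poset_copies T r \<F>) * (t + 1) ^ (t + 1)"
      by (simp add: assms(5))
    from of_nat_mono[OF this, where 'a = real]
    have "real (card E') * real m ^ (t - 1) \<le> card (poset_copies T r \<F>) * real (t + 1) ^ (t + 1)"
      by (simp only: of_nat_mult of_nat_power)
    moreover have "(\<epsilon> * n * c / 8) * (a * n) ^ (t - 1) \<le> real (card E') * real m ^ (t - 1)"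
      using cardE' m a by (intro mult_mono power_mono) auto
    moreover have "(\<epsilon> * n * c / 8) * (a * n) ^ (t - 1) = \<epsilon> / 8 * a ^ (t - 1) * real n ^ t * c"
      using t by (cases t) (auto simp: power_mult_distrib)
    ultimately have "\<epsilon> / 8 * a ^ (t - 1) * real n ^ t * c
        \<le> card (poset_copies T r \<F>) * real (t + 1) ^ (t + 1)" by linarith
    then have "\<epsilon> / 8 * a ^ (t - 1) * real n ^ t * c / real (t + 1) ^ (t + 1)
        \<le> card (poset_copies T r \<F>)"
      by (subst pos_divide_le_eq) auto
    then show ?thesis by (simp add: \<delta>_def c_def)
  qed
  moreover have "\<delta> > 0" using assms(6) a by (simp add: \<delta>_def)
  ultimately show ?thesis by blast
qed

end
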